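(* Consider the MTDC system under the decentralized PI controller with deadband, with closed-loop dynamics $$\dot V=-E\mathcal{L}_RV-EK^P(V-V^{\text{nom}})-EK^Iz+EI^{\text{inj}},\qquad \dot z=[V-\overline{V}]^+-[\underline{V}-V]^+,$$ with positive gains $K_i^P,K_i^I$, and assume $\underline{V}_i\le V_i^{\text{nom}}\le\overline{V}_i$ for all $i\in\mathcal{V}$. If the voltage bounds are uniform, i.e. $\overline{V}_i=\overline{V}_j$ and $\underline{V}_i=\underline{V}_j$ for all $i,j\in\mathcal{V}$, then the voltage-range objective is satisfied: for every constant disturbance $I^{\text{inj}}\in\mathbb{R}^n$ and every solution of the closed-loop dynamics, $$\lim_{t\to\infty}V_i(t)\in[\underline{V}_i,\overline{V}_i]\quad\text{for all } i\in\mathcal{V}.$$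
   Context: MTDC system: let $\mathcal{G}$ be a fixed, undirected, connected graph with vertex set $\mathcal{V}=\{1,\dots,n\}$ (terminals) and edge set $\mathcal{E}$ (lines); the neighbours of $i$ are $\mathcal{N}_i$. Each edge $(i,j)$ has resistance $R_{ij}=R_{ji}>0$ and each terminal has capacitance $C_i>0$. The voltages obey $C_i\dot V_i=-\sum_{j\in\mathcal{N}_i}\frac{1}{R_{ij}}(V_i-V_j)+I_i^{\text{inj}}+u_i$ for $i\in\mathcal{V}$, where $I_i^{\text{inj}}$ is a constant uncontrolled injected current and $u_i$ is the controlled injected current. The deadband PI controller is $u_i=-K_i^P(V_i-V_i^{\text{nom}})-K_i^Iz_i$, $\dot z_i=[V_i-\overline{V}_i]^+-[\underline{V}_i-V_i]^+$, where $[x]^+=\max(x,0)$ (componentwise for vectors). Notation: $E=\operatorname{diag}(C_1^{-1},\dots,C_n^{-1})$, $K^P=\operatorname{diag}(K_1^P,\dots,K_n^P)$, $K^I=\operatorname{diag}(K_1^I,\dots,K_n^I)$; $V,z,V^{\text{nom}},\overline{V},\underline{V},I^{\text{inj}}\in\mathbb{R}^n$ are the vectors with the corresponding components; $\mathcal{L}_R$ is the weighted graph Laplacian with edge weights $1/R_{ij}$. The nominal voltages are equal: $V_i^{\text{nom}}=V_j^{\text{nom}}$ for all $i,j\in\mathcal{V}$. *)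

theory Defs
  imports "HOL-Analysis.Analysis" "Graph_Theory.Digraph_Component"
begin

definition diag_matrix :: "real ^ 'n \<Rightarrow> real ^ 'n ^ 'n" where
  "diag_matrix d = (\<chi> i j. if i = j then d $ i else 0)"

definition neighbours :: "'n pair_pre_digraph \<Rightarrow> 'n \<Rightarrow> 'n set" where
  "neighbours G i = {j. (i, j) \<in> parcs G}"

definition weighted_laplacian ::
    "'n::finite pair_pre_digraph \<Rightarrow> ('n \<Rightarrow> 'n \<Rightarrow> real) \<Rightarrow> real ^ 'n ^ 'n" where
  "weighted_laplacian G w = (\<chi> i j.
     if i = j then (\<Sum>k \<in> neighbours G i. w i k)
     else if j \<in> neighbours G i then - w i j
     else 0)"

definition pos_part :: "real ^ 'n \<Rightarrow> real ^ 'n" where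
  "pos_part x = (\<chi> i. max (x $ i) 0)"

lemma diag_matrix_mult_component:
  "(diag_matrix d *v x) $ i = d $ i * (x $ i :: real)"
  by (simp add: diag_matrix_def matrix_vector_mult_def if_distrib[of "\<lambda>a. a * _"] cong: if_cong)

(* On a loop-free graph, the Laplacian yields the line-current sum of Ohm's law. *)
lemma weighted_laplacian_mult_component:
  assumes "pair_graph G"
  shows "(weighted_laplacian G w *v x) $ i = (\<Sum>j \<in> neighbours G i. w i j * (x $ i - x $ j))"
proof -
  interpret pair_graph G by (rule assms)
  have ni: "i \<notin> neighbours G i"
    using pair_no_loops by (fastforce simp: neighbours_def)
  have "(weighted_laplacian G w *v x) $ i =
      (\<Sum>k \<in> neighbours G i. w i k) * x $ i
      + (\<Sum>j \<in> UNIV - {i}. (if j \<in> neighbours G i then - w i j else 0) * x $ j)"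
    unfolding matrix_vector_mult_def weighted_laplacian_def
    by (subst sum.remove[of UNIV i]) (auto intro!: sum.cong)
  also have "(\<Sum>j \<in> UNIV - {i}. (if j \<in> neighbours G i then - w i j else 0) * x $ j)
      = (\<Sum>j \<in> neighbours G i. - w i j * x $ j)"
    using ni by (intro sum.mono_neutral_cong_right) auto
  finally show ?thesis
    by (simp add: sum_distrib_right right_diff_distrib sum_subtractf sum_negf)
qed

end

theory Submission
  imports Defs
begin

text \<open>
  Differentiating the voltage equation once eliminates the integral state and the constant
  disturbance. With \<open>x = V\<close>, \<open>q = V'\<close>, \<open>D = L\<^sub>R + K\<^sup>P\<close> and the deadband function
  \<open>phi(s) = [s - b]\<^sup>+ - [a - s]\<^sup>+\<close>, the closed loop becomes
  \<open>C q' = - D q - K\<^sup>I phi(x)\<close>, \<open>x' = q\<close>: coupled oscillators with mass \<open>C\<close>, damping \<open>D\<close> and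
  restoring force \<open>K\<^sup>I phi\<close>. The Laplacian of an undirected graph is symmetric and positive
  semidefinite, so \<open>D\<close> is symmetric and bounded below by \<open>K\<^sup>P\<close>. The force is the gradient of
  a convex potential whose minimisers are exactly the points of the box \<open>[a, b]\<close>, so this is
  a heavy ball with friction, and such a ball settles at a minimiser.

  Two Lyapunov functions make this precise. The mechanical energy
  \<open>H = (\<Sum> C q\<^sup>2 + K\<^sup>I phi(x)\<^sup>2) / 2\<close> is nonincreasing because \<open>H' = - q \<bullet> D q\<close>. For any point
  \<open>p\<close> of the box, the functional
  \<open>W\<^sub>p = (x - p) \<bullet> D (x - p) / 2 + (x - p) \<bullet> C q + M H\<close> with \<open>M\<close> large satisfies both
  \<open>W\<^sub>p' \<le> - 2 H\<close> (\<open>distance_functional_dissipation\<close>) and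
  \<open>W\<^sub>p \<ge> (\<Sum> K\<^sup>P (x - p)\<^sup>2) / 4\<close> (\<open>distance_functional_lower_bound\<close>).

  Since \<open>H\<close> is nonincreasing and \<open>W\<^sub>p\<close> nonnegative, integration of \<open>W\<^sub>p' \<le> - 2 H\<close> gives
  \<open>2 t H(t) \<le> W\<^sub>p(0)\<close>, hence \<open>H\<close> tends to \<open>0\<close>: the velocities vanish and the voltages approach
  the box. To see that they do not drift along the box, use that the trajectory is bounded and
  choose a limit point \<open>p\<close>, which lies in the box. For this \<open>p\<close> the functional \<open>W\<^sub>p\<close> is
  nonincreasing and tends to \<open>0\<close> along a sequence of times, hence it tends to \<open>0\<close>, and the lower
  bound forces \<open>x\<close> to converge to \<open>p\<close> (\<open>convergence\<close>).
\<close>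

section \<open>Calculus on a half-line and limits\<close>

lemma nonincreasing_on_halfline:
  fixes f f' :: "real \<Rightarrow> real"
  assumes deriv: "\<And>t. t \<ge> 0 \<Longrightarrow> (f has_real_derivative f' t) (at t within {0..})"
    and nonpos: "\<And>t. t \<ge> 0 \<Longrightarrow> f' t \<le> 0"
    and "0 \<le> s" "s \<le> t"
  shows "f t \<le> f s"
proof (rule DERIV_nonpos_imp_decreasing_open[OF \<open>s \<le> t\<close>])
  fix u assume u: "s < u" "u < t"
  then have "at u within {0..} = at u"
    using \<open>0 \<le> s\<close> by (intro at_within_interior) auto
  then show "\<exists>y. DERIV f u :> y \<and> y \<le> 0"
    using deriv[of u] nonpos[of u] u \<open>0 \<le> s\<close> by auto
next
  have "continuous_on {0..} f"
    using deriv by (auto simp: continuous_on_eq_continuous_within intro: DERIV_continuous)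
  then show "continuous_on {s..t} f"
    by (rule continuous_on_subset) (use \<open>0 \<le> s\<close> in auto)
qed

text \<open>
  Squaring removes the kink of the positive part. This is what keeps the energy differentiable
  although the control law is not.
\<close>

lemma has_real_derivative_max_0_squared:
  "((\<lambda>s. (max s 0)\<^sup>2) has_real_derivative 2 * max x 0) (at x)" for x :: real
proof -
  consider "x > 0" | "x < 0" | "x = 0" by linarith
  then show ?thesis
  proof cases
    case 1
    have "((\<lambda>s. s\<^sup>2) has_real_derivative 2 * max x 0) (at x)"
      using 1 by (auto intro!: derivative_eq_intros)
    then show ?thesis
      by (rule has_field_derivative_transform_within_open[of _ _ _ "{0<..}"]) (use 1 in auto)
  next
    case 2
    have "((\<lambda>s. 0) has_real_derivative 2 * max x 0) (at x)"
      using 2 by (auto intro!: derivative_eq_intros)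
    then show ?thesis
      by (rule has_field_derivative_transform_within_open[of _ _ _ "{..<0}"]) (use 2 in auto)
  next
    case 3
    have "isCont (\<lambda>z::real. max z 0) 0"
      by (intro continuous_intros)
    moreover have "(max z 0)\<^sup>2 - (max x 0)\<^sup>2 = max z 0 * (z - x)" for z
      using 3 by (auto simp: power2_eq_square max_def)
    ultimately show ?thesis
      unfolding CARAT_DERIV using 3 by (intro exI[of _ "\<lambda>z. max z 0"]) simp
  qed
qed

lemma tendsto_0_if_weighted_square_le:
  fixes f g :: "'b \<Rightarrow> real"
  assumes "c > 0" and le: "\<And>t. c * (f t)\<^sup>2 \<le> g t" and "(g \<longlongrightarrow> 0) F"
  shows "(f \<longlongrightarrow> 0) F"
proof -
  have lim: "((\<lambda>t. g t / c) \<longlongrightarrow> 0) F"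
    using tendsto_divide[OF assms(3) tendsto_const, of c] \<open>c > 0\<close> by simp
  have "((\<lambda>t. (f t)\<^sup>2) \<longlongrightarrow> 0) F"
    by (rule tendsto_sandwich[OF _ _ tendsto_const lim])
      (use le \<open>c > 0\<close> in \<open>auto simp: field_simps\<close>)
  then show ?thesis by simp
qed

section \<open>The deadband function\<close>

definition deadband :: "real \<Rightarrow> real \<Rightarrow> real \<Rightarrow> real" where
  "deadband a b s = max (s - b) 0 - max (a - s) 0"

lemma deadband_eq_0_iff: "a \<le> b \<Longrightarrow> deadband a b s = 0 \<longleftrightarrow> s \<in> {a..b}"
  by (auto simp: deadband_def max_def)

lemma tendsto_deadband [tendsto_intros]:
  "(f \<longlongrightarrow> l) F \<Longrightarrow> ((\<lambda>t. deadband a b (f t)) \<longlongrightarrow> deadband a b l) F"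
  unfolding deadband_def by (intro tendsto_intros)

text \<open>
  Half the square of the deadband function is an antiderivative of it: at most one of the two
  positive parts is nonzero, so the mixed term of the square vanishes. The potential energy can
  therefore be written as \<open>deadband\<^sup>2 / 2\<close>.
\<close>

lemma has_real_derivative_deadband_squared:
  assumes "a \<le> b"
  shows "((\<lambda>s. (deadband a b s)\<^sup>2) has_real_derivative 2 * deadband a b x) (at x)"
proof -
  have split: "(deadband a b s)\<^sup>2 = (max (s - b) 0)\<^sup>2 + (max (a - s) 0)\<^sup>2" for s
    using assms by (auto simp: deadband_def max_def power2_commute)
  have "((\<lambda>s. (max (s - b) 0)\<^sup>2) has_real_derivative 2 * max (x - b) 0 * 1) (at x)"
    by (rule DERIV_chain2[OF has_real_derivative_max_0_squared])
      (auto intro!: derivative_eq_intros)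
  moreover have "((\<lambda>s. (max (a - s) 0)\<^sup>2) has_real_derivative 2 * max (a - x) 0 * (-1)) (at x)"
    by (rule DERIV_chain2[OF has_real_derivative_max_0_squared])
      (auto intro!: derivative_eq_intros)
  ultimately show ?thesis
    unfolding split by (rule DERIV_cong[OF DERIV_add]) (simp add: deadband_def)
qed

text \<open>
  The absolute value of \<open>deadband a b s\<close> is the distance from \<open>s\<close> to the band, hence at most the
  distance from \<open>s\<close> to \<open>p\<close>, and it has the sign of \<open>s - p\<close> outside the band. In \<open>W\<^sub>p'\<close> this bounds
  the work term \<open>(x - p) phi(x)\<close> from below by potential energy.
\<close>

lemma deadband_squared_le:
  assumes "p \<in> {a..b}"
  shows "(deadband a b s)\<^sup>2 \<le> (s - p) * deadband a b s"
proof -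
  consider "s > b" | "s < a" | "s \<in> {a..b}" by fastforce
  then show ?thesis
  proof cases
    case 1
    then have "deadband a b s = s - b" using assms by (auto simp: deadband_def)
    then show ?thesis using 1 assms by (auto simp: power2_eq_square intro!: mult_right_mono)
  next
    case 2
    then have "deadband a b s = s - a" using assms by (auto simp: deadband_def)
    then show ?thesis using 2 assms by (auto simp: power2_eq_square intro!: mult_right_mono_neg)
  next
    case 3
    then have "deadband a b s = 0" using assms by (auto simp: deadband_def)
    then show ?thesis by simp
  qed
qed

section \<open>Damped oscillators in a deadband potential\<close>

text \<open>
  The second-order form of the closed loop: \<open>D\<close> is the sum of the Laplacian and the proportional
  gains, and the lower bound \<open>P\<close> of \<open>D\<close> is the part contributed by the gains.
\<close>

locale damped_deadband_system =
  fixes D :: "real ^ 'n ^ 'n::finite"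
    and C P K a b :: "real ^ 'n"
    and x q :: "real \<Rightarrow> real ^ 'n"
  assumes D_symmetric: "transpose D = D"
    and D_coercive: "\<And>y. (\<Sum>i\<in>UNIV. P $ i * (y $ i)\<^sup>2) \<le> y \<bullet> (D *v y)"
    and C_pos: "\<And>i. C $ i > 0" and P_pos: "\<And>i. P $ i > 0" and K_pos: "\<And>i. K $ i > 0"
    and a_le_b: "\<And>i. a $ i \<le> b $ i"
    and x_deriv: "\<And>t. t \<ge> 0 \<Longrightarrow> (x has_vector_derivative q t) (at t within {0..})"
    and q_deriv: "\<And>t i. t \<ge> 0 \<Longrightarrow> ((\<lambda>t. q t $ i) has_real_derivative
           - ((D *v q t) $ i + K $ i * deadband (a $ i) (b $ i) (x t $ i)) / C $ i)
           (at t within {0..})"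
begin

abbreviation phi :: "real \<Rightarrow> 'n \<Rightarrow> real" where
  "phi t i \<equiv> deadband (a $ i) (b $ i) (x t $ i)"

definition energy :: "real \<Rightarrow> real" where
  "energy t = (\<Sum>i\<in>UNIV. C $ i * (q t $ i)\<^sup>2 + K $ i * (phi t i)\<^sup>2) / 2"

text \<open>
  The weight only has to satisfy \<open>2 C \<le> weight * P\<close> in every component (\<open>weight_bound\<close>); the sum
  is a convenient common upper bound of the ratios.
\<close>

definition weight :: real where
  "weight = (\<Sum>i\<in>UNIV. 2 * C $ i / P $ i)"

text \<open>
  This is \<open>W\<^sub>p\<close>. The quadratic and the mixed term alone have the derivative
  \<open>q \<bullet> C q - (x - p) \<bullet> K phi\<close>; its first summand has the wrong sign and is absorbed by the
  dissipation of \<open>weight * energy\<close>.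
\<close>

definition distance_functional :: "real ^ 'n \<Rightarrow> real \<Rightarrow> real" where
  "distance_functional p t = (x t - p) \<bullet> (D *v (x t - p)) / 2
     + (\<Sum>i\<in>UNIV. C $ i * (x t $ i - p $ i) * q t $ i) + weight * energy t"

lemma weight_bound: "2 * C $ i \<le> weight * P $ i"
proof -
  have "2 * C $ i / P $ i \<le> weight"
    unfolding weight_def
    by (rule member_le_sum) (auto intro!: divide_nonneg_pos simp: less_imp_le C_pos P_pos)
  then show ?thesis using P_pos[of i] by (simp add: field_simps)
qed

lemma weight_nonneg: "0 \<le> weight"
  unfolding weight_def by (intro sum_nonneg) (simp add: less_imp_le C_pos P_pos)

lemma energy_nonneg: "0 \<le> energy t"
  unfolding energy_def
  by (intro divide_nonneg_nonneg sum_nonneg add_nonneg_nonneg mult_nonneg_nonneg)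
    (auto simp: less_imp_le C_pos K_pos)

lemma x_component_deriv:
  "t \<ge> 0 \<Longrightarrow> ((\<lambda>t. x t $ i) has_real_derivative q t $ i) (at t within {0..})"
  unfolding has_real_derivative_iff_has_vector_derivative
  by (rule bounded_linear.has_vector_derivative[OF bounded_linear_vec_nth x_deriv])

lemma phi_squared_deriv:
  "t \<ge> 0 \<Longrightarrow> ((\<lambda>t. (phi t i)\<^sup>2) has_real_derivative 2 * phi t i * q t $ i) (at t within {0..})"
  by (rule DERIV_chain2[OF has_real_derivative_deadband_squared[OF a_le_b] x_component_deriv])

lemma energy_deriv:
  assumes "t \<ge> 0"
  shows "(energy has_real_derivative - (q t \<bullet> (D *v q t))) (at t within {0..})"
proof -
  have q_squared: "((\<lambda>t. (q t $ i)\<^sup>2) has_real_derivative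
      2 * q t $ i * (- ((D *v q t) $ i + K $ i * phi t i) / C $ i)) (at t within {0..})" for i
    by (rule DERIV_cong[OF DERIV_power[OF q_deriv[OF assms]]]) simp
  have "(energy has_real_derivative
      (\<Sum>i\<in>UNIV. C $ i * (2 * q t $ i * (- ((D *v q t) $ i + K $ i * phi t i) / C $ i))
        + K $ i * (2 * phi t i * q t $ i)) / 2) (at t within {0..})"
    unfolding energy_def
    by (intro DERIV_cdivide DERIV_sum DERIV_add DERIV_cmult q_squared phi_squared_deriv assms)
  also have "(\<Sum>i\<in>UNIV. C $ i * (2 * q t $ i * (- ((D *v q t) $ i + K $ i * phi t i) / C $ i))
        + K $ i * (2 * phi t i * q t $ i)) / 2 = - (q t \<bullet> (D *v q t))"
    unfolding inner_vec_def sum_divide_distrib sum_negf[symmetric]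
  proof (intro sum.cong refl)
    fix i
    show "(C $ i * (2 * q t $ i * (- ((D *v q t) $ i + K $ i * phi t i) / C $ i))
        + K $ i * (2 * phi t i * q t $ i)) / 2 = - (q t $ i \<bullet> (D *v q t) $ i)"
      using C_pos[of i] by (simp add: field_simps)
  qed
  finally show ?thesis .
qed

lemma D_nonneg: "0 \<le> y \<bullet> (D *v y)"
proof -
  have "0 \<le> (\<Sum>i\<in>UNIV. P $ i * (y $ i)\<^sup>2)"
    by (intro sum_nonneg mult_nonneg_nonneg) (auto simp: less_imp_le P_pos)
  then show ?thesis using D_coercive by (rule order_trans)
qed

lemma energy_nonincreasing: "0 \<le> s \<Longrightarrow> s \<le> t \<Longrightarrow> energy t \<le> energy s"
  by (rule nonincreasing_on_halfline[OF energy_deriv])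
    (simp_all add: D_nonneg)

text \<open>
  By the symmetry of \<open>D\<close>, the derivative \<open>(x - p) \<bullet> D q\<close> of the quadratic term is exactly the
  damping contribution to the derivative of the mixed term, and the two cancel.
\<close>

lemma distance_functional_deriv:
  assumes "t \<ge> 0"
  shows "(distance_functional p has_real_derivative
      (\<Sum>i\<in>UNIV. C $ i * (q t $ i)\<^sup>2 - K $ i * (x t $ i - p $ i) * phi t i)
        - weight * (q t \<bullet> (D *v q t))) (at t within {0..})"
proof -
  let ?d = "\<lambda>t. x t - p"
  have d: "(?d has_vector_derivative q t) (at t within {0..})"
    using has_vector_derivative_diff[OF x_deriv[OF assms] has_vector_derivative_const] by simp
  have sym: "q t \<bullet> (D *v ?d t) = ?d t \<bullet> (D *v q t)"
    by (metis D_symmetric dot_lmul_matrix inner_commute transpose_matrix_vector)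
  have "((\<lambda>t. ?d t \<bullet> (D *v ?d t)) has_real_derivative
      ?d t \<bullet> (D *v q t) + q t \<bullet> (D *v ?d t)) (at t within {0..})"
    unfolding has_real_derivative_iff_has_vector_derivative
    by (rule bounded_bilinear.has_vector_derivative[OF bounded_bilinear_inner d
        bounded_linear.has_vector_derivative[OF matrix_vector_mul_bounded_linear d]])
  then have quad: "((\<lambda>t. ?d t \<bullet> (D *v ?d t) / 2) has_real_derivative ?d t \<bullet> (D *v q t))
      (at t within {0..})"
    unfolding sym by (rule DERIV_cong[OF DERIV_cdivide]) simp
  have "((\<lambda>t. \<Sum>i\<in>UNIV. C $ i * (x t $ i - p $ i) * q t $ i) has_real_derivative
      (\<Sum>i\<in>UNIV. C $ i * q t $ i * q t $ i
        + C $ i * (x t $ i - p $ i) * (- ((D *v q t) $ i + K $ i * phi t i) / C $ i)))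
      (at t within {0..})"
  proof (intro DERIV_sum)
    fix i
    have "((\<lambda>t. C $ i * (x t $ i - p $ i)) has_real_derivative C $ i * q t $ i)
        (at t within {0..})"
      by (rule DERIV_cmult[OF DERIV_cong[OF DERIV_diff[OF x_component_deriv[OF assms] DERIV_const]]])
        simp
    from DERIV_mult[OF this q_deriv[OF assms, of i]]
    show "((\<lambda>t. C $ i * (x t $ i - p $ i) * q t $ i) has_real_derivative
        C $ i * q t $ i * q t $ i
        + C $ i * (x t $ i - p $ i) * (- ((D *v q t) $ i + K $ i * phi t i) / C $ i))
        (at t within {0..})"
      by (simp only: add.commute mult.commute)
  qed
  also have "(\<Sum>i\<in>UNIV. C $ i * q t $ i * q t $ i
        + C $ i * (x t $ i - p $ i) * (- ((D *v q t) $ i + K $ i * phi t i) / C $ i))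
      = (\<Sum>i\<in>UNIV. (C $ i * (q t $ i)\<^sup>2 - K $ i * (x t $ i - p $ i) * phi t i)
          - (x t $ i - p $ i) * (D *v q t) $ i)"
  proof (intro sum.cong refl)
    fix i
    show "C $ i * q t $ i * q t $ i
        + C $ i * (x t $ i - p $ i) * (- ((D *v q t) $ i + K $ i * phi t i) / C $ i)
      = (C $ i * (q t $ i)\<^sup>2 - K $ i * (x t $ i - p $ i) * phi t i)
          - (x t $ i - p $ i) * (D *v q t) $ i"
      using C_pos[of i] by (simp add: field_simps power2_eq_square)
  qed
  also have "\<dots> = (\<Sum>i\<in>UNIV. C $ i * (q t $ i)\<^sup>2 - K $ i * (x t $ i - p $ i) * phi t i)
      - ?d t \<bullet> (D *v q t)"
    by (simp add: sum_subtractf inner_vec_def)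
  finally have cross: "((\<lambda>t. \<Sum>i\<in>UNIV. C $ i * (x t $ i - p $ i) * q t $ i) has_real_derivative
      (\<Sum>i\<in>UNIV. C $ i * (q t $ i)\<^sup>2 - K $ i * (x t $ i - p $ i) * phi t i)
        - ?d t \<bullet> (D *v q t)) (at t within {0..})" .
  show ?thesis
    unfolding distance_functional_def
    by (rule DERIV_cong[OF DERIV_add[OF DERIV_add[OF quad cross] DERIV_cmult[OF energy_deriv[OF assms]]]])
      simp
qed

text \<open>
  Half of the dissipation \<open>weight * P q\<^sup>2 \<ge> 2 C q\<^sup>2\<close> cancels the term \<open>C q\<^sup>2\<close> of the wrong sign; the
  other half remains as kinetic energy. The potential energy comes from \<open>deadband_squared_le\<close>.
\<close>

lemma distance_functional_dissipation:
  assumes p: "\<And>i. p $ i \<in> {a $ i..b $ i}"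
  shows "(\<Sum>i\<in>UNIV. C $ i * (q t $ i)\<^sup>2 - K $ i * (x t $ i - p $ i) * phi t i)
        - weight * (q t \<bullet> (D *v q t)) \<le> - 2 * energy t"
proof -
  have "(\<Sum>i\<in>UNIV. C $ i * (q t $ i)\<^sup>2 - K $ i * (x t $ i - p $ i) * phi t i)
        - weight * (q t \<bullet> (D *v q t))
      \<le> (\<Sum>i\<in>UNIV. C $ i * (q t $ i)\<^sup>2 - K $ i * (x t $ i - p $ i) * phi t i)
        - weight * (\<Sum>i\<in>UNIV. P $ i * (q t $ i)\<^sup>2)"
    by (intro diff_left_mono mult_left_mono D_coercive weight_nonneg)
  also have "\<dots> = (\<Sum>i\<in>UNIV. C $ i * (q t $ i)\<^sup>2 - K $ i * (x t $ i - p $ i) * phi t i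
        - weight * P $ i * (q t $ i)\<^sup>2)"
    by (simp add: sum_subtractf sum_distrib_left mult.assoc)
  also have "\<dots> \<le> (\<Sum>i\<in>UNIV. - (C $ i * (q t $ i)\<^sup>2 + K $ i * (phi t i)\<^sup>2))"
  proof (intro sum_mono)
    fix i
    have "2 * C $ i * (q t $ i)\<^sup>2 \<le> weight * P $ i * (q t $ i)\<^sup>2"
      by (intro mult_right_mono weight_bound) simp
    moreover have "K $ i * (phi t i)\<^sup>2 \<le> K $ i * ((x t $ i - p $ i) * phi t i)"
      by (intro mult_left_mono deadband_squared_le p) (simp add: less_imp_le K_pos)
    ultimately show "C $ i * (q t $ i)\<^sup>2 - K $ i * (x t $ i - p $ i) * phi t i
        - weight * P $ i * (q t $ i)\<^sup>2 \<le> - (C $ i * (q t $ i)\<^sup>2 + K $ i * (phi t i)\<^sup>2)"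
      by (simp add: mult.assoc)
  qed
  also have "\<dots> = - 2 * energy t"
    unfolding energy_def sum_negf by simp
  finally show ?thesis .
qed

lemma distance_functional_nonincreasing:
  assumes p: "\<And>i. p $ i \<in> {a $ i..b $ i}" and "0 \<le> s" "s \<le> t"
  shows "distance_functional p t \<le> distance_functional p s"
proof (rule nonincreasing_on_halfline[OF distance_functional_deriv])
  fix t
  show "(\<Sum>i\<in>UNIV. C $ i * (q t $ i)\<^sup>2 - K $ i * (x t $ i - p $ i) * phi t i)
      - weight * (q t \<bullet> (D *v q t)) \<le> 0"
    by (rule order_trans[OF distance_functional_dissipation[OF p]]) (simp add: energy_nonneg)
qed (use assms in auto)

text \<open>
  Half of the quadratic term \<open>P d\<^sup>2 / 2\<close>, where \<open>d = x - p\<close>, pays together with the kinetic energy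
  for the indefinite mixed term \<open>C d q\<close>, by completing the square.
\<close>

lemma distance_functional_lower_bound:
  "(\<Sum>i\<in>UNIV. P $ i * (x t $ i - p $ i)\<^sup>2) / 4 \<le> distance_functional p t"
proof -
  have "(\<Sum>i\<in>UNIV. P $ i * (x t $ i - p $ i)\<^sup>2) / 4
      \<le> (\<Sum>i\<in>UNIV. P $ i * (x t $ i - p $ i)\<^sup>2 / 2 + C $ i * (x t $ i - p $ i) * q t $ i
          + weight * (C $ i * (q t $ i)\<^sup>2 + K $ i * (phi t i)\<^sup>2) / 2)"
    unfolding sum_divide_distrib
  proof (intro sum_mono)
    fix i
    let ?d = "x t $ i - p $ i" and ?q = "q t $ i"
    have "0 \<le> P $ i * (?d / 2 + C $ i / P $ i * ?q)\<^sup>2"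
      by (intro mult_nonneg_nonneg) (auto simp: less_imp_le P_pos)
    also have "\<dots> = P $ i * ?d\<^sup>2 / 4 + C $ i * ?d * ?q + (C $ i / P $ i) * (C $ i * ?q\<^sup>2)"
      using P_pos[of i] by (simp add: power2_eq_square field_simps)
    also have "(C $ i / P $ i) * (C $ i * ?q\<^sup>2) \<le> (weight / 2) * (C $ i * ?q\<^sup>2)"
      using weight_bound[of i] P_pos[of i] C_pos[of i]
      by (intro mult_right_mono) (auto simp: field_simps)
    also have "(weight / 2) * (C $ i * ?q\<^sup>2) \<le> weight * (C $ i * ?q\<^sup>2 + K $ i * (phi t i)\<^sup>2) / 2"
      using weight_nonneg K_pos[of i] by (simp add: algebra_simps)
    finally show "P $ i * ?d\<^sup>2 / 4 \<le> P $ i * ?d\<^sup>2 / 2 + C $ i * ?d * ?q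
        + weight * (C $ i * ?q\<^sup>2 + K $ i * (phi t i)\<^sup>2) / 2"
      by simp
  qed
  also have "\<dots> = (\<Sum>i\<in>UNIV. P $ i * ((x t - p) $ i)\<^sup>2) / 2
      + (\<Sum>i\<in>UNIV. C $ i * (x t $ i - p $ i) * q t $ i) + weight * energy t"
    unfolding energy_def by (simp add: sum.distrib flip: sum_divide_distrib sum_distrib_left)
  also have "\<dots> \<le> distance_functional p t"
    unfolding distance_functional_def using D_coercive[of "x t - p"] by simp
  finally show ?thesis .
qed

lemma distance_functional_nonneg: "0 \<le> distance_functional p t"
proof -
  have "0 \<le> (\<Sum>i\<in>UNIV. P $ i * (x t $ i - p $ i)\<^sup>2) / 4"
    by (intro divide_nonneg_nonneg sum_nonneg mult_nonneg_nonneg) (auto simp: less_imp_le P_pos)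
  then show ?thesis using distance_functional_lower_bound by (rule order_trans)
qed

text \<open>
  The energy dominates its later values, so \<open>W' \<le> - 2 energy\<close> yields
  \<open>2 t * energy t \<le> W 0\<close>. Any point of the box serves as a reference point; here it is the corner
  \<open>a\<close>.
\<close>

lemma energy_tendsto_0: "(energy \<longlongrightarrow> 0) at_top"
proof -
  let ?W = "distance_functional a"
  have a: "a $ i \<in> {a $ i..b $ i}" for i using a_le_b by simp
  \<comment> \<open>On \<open>[0, t]\<close> the function \<open>?W s + 2 * energy t * s\<close> is nonincreasing in \<open>s\<close>.\<close>
  have bound: "energy t \<le> ?W 0 / (2 * t)" if "t > 0" for t
  proof -
    have "?W t + 2 * energy t * t \<le> ?W 0 + 2 * energy t * 0"
    proof (rule DERIV_nonpos_imp_decreasing_open[of 0 t])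
      show "0 \<le> t" using that by simp
    next
      fix s assume s: "0 < s" "s < t"
      have *: "at s within {0..} = at s"
        using s by (intro at_within_interior) auto
      have "((\<lambda>s. ?W s + 2 * energy t * s) has_real_derivative
          ((\<Sum>i\<in>UNIV. C $ i * (q s $ i)\<^sup>2 - K $ i * (x s $ i - a $ i) * phi s i)
        - weight * (q s \<bullet> (D *v q s))) + 2 * energy t) (at s)"
        using distance_functional_deriv[of s a] s unfolding *
        by (auto intro!: derivative_eq_intros)
      moreover have "energy t \<le> energy s"
        using s by (intro energy_nonincreasing) auto
      ultimately show "\<exists>y. ((\<lambda>s. ?W s + 2 * energy t * s) has_real_derivative y) (at s) \<and> y \<le> 0"
        using distance_functional_dissipation[OF a, of s] by force
    next
      have "continuous_on {0..} ?W"
        using distance_functional_deriv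
        by (auto simp: continuous_on_eq_continuous_within intro: DERIV_continuous)
      then show "continuous_on {0..t} (\<lambda>s. ?W s + 2 * energy t * s)"
        by (intro continuous_intros) (rule continuous_on_subset, auto)
    qed
    then show ?thesis
      using distance_functional_nonneg[of a t] that by (simp add: field_simps)
  qed
  have lim: "((\<lambda>t. ?W 0 / (2 * t)) \<longlongrightarrow> 0) at_top"
    by (intro tendsto_divide_0[OF tendsto_const] filterlim_at_top_imp_at_infinity
        filterlim_tendsto_pos_mult_at_top[OF tendsto_const] filterlim_ident) simp
  show ?thesis
    by (rule tendsto_sandwich[OF _ _ tendsto_const lim])
      (auto simp: energy_nonneg bound intro: eventually_mono[OF eventually_gt_at_top[of 0]])
qed

lemma energy_dominates:
  "C $ i * (q t $ i)\<^sup>2 \<le> 2 * energy t" "K $ i * (phi t i)\<^sup>2 \<le> 2 * energy t"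
proof -
  have "C $ i * (q t $ i)\<^sup>2 + K $ i * (phi t i)\<^sup>2 \<le> 2 * energy t"
    unfolding energy_def
    using member_le_sum[of i UNIV "\<lambda>i. C $ i * (q t $ i)\<^sup>2 + K $ i * (phi t i)\<^sup>2"]
    by (simp add: less_imp_le C_pos K_pos)
  moreover have "0 \<le> C $ i * (q t $ i)\<^sup>2" "0 \<le> K $ i * (phi t i)\<^sup>2"
    by (simp_all add: less_imp_le C_pos K_pos)
  ultimately show "C $ i * (q t $ i)\<^sup>2 \<le> 2 * energy t" "K $ i * (phi t i)\<^sup>2 \<le> 2 * energy t"
    by linarith+
qed

lemma q_tendsto_0: "((\<lambda>t. q t $ i) \<longlongrightarrow> 0) at_top"
  by (rule tendsto_0_if_weighted_square_le[OF C_pos energy_dominates(1)])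
    (use tendsto_mult_right_zero[OF energy_tendsto_0, of 2] in simp)

lemma phi_tendsto_0: "((\<lambda>t. phi t i) \<longlongrightarrow> 0) at_top"
  by (rule tendsto_0_if_weighted_square_le[OF K_pos energy_dominates(2)])
    (use tendsto_mult_right_zero[OF energy_tendsto_0, of 2] in simp)

lemma component_le_distance_functional:
  "P $ i * (x t $ i - p $ i)\<^sup>2 \<le> 4 * distance_functional p t"
  using distance_functional_lower_bound[of t p]
    member_le_sum[of i UNIV "\<lambda>i. P $ i * (x t $ i - p $ i)\<^sup>2"]
  by (simp add: less_imp_le P_pos)

lemma bounded_trajectory: "bounded (x ` {0..})"
proof -
  define r where "r = (\<chi> i. sqrt (4 * distance_functional a 0 / P $ i))"
  have "\<bar>x t $ i - a $ i\<bar> \<le> r $ i" if "t \<ge> 0" for t i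
  proof -
    have "P $ i * (x t $ i - a $ i)\<^sup>2 \<le> 4 * distance_functional a 0"
      using component_le_distance_functional[of i t a]
        distance_functional_nonincreasing[of a 0 t] a_le_b that by force
    then have "\<bar>x t $ i - a $ i\<bar> \<le> sqrt (4 * distance_functional a 0 / P $ i)"
      using P_pos[of i] by (intro real_le_rsqrt) (simp add: field_simps)
    then show ?thesis by (simp add: r_def)
  qed
  then have "x t \<in> cbox (a - r) (a + r)" if "t \<ge> 0" for t
    using that by (simp add: mem_box_cart abs_le_iff algebra_simps)
  then have "x ` {0..} \<subseteq> cbox (a - r) (a + r)" by auto
  then show ?thesis using bounded_cbox bounded_subset by blast
qed

text \<open>
  The functional at \<open>p\<close> is nonincreasing for every \<open>p\<close> in the box. Taking for \<open>p\<close> a limit point of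
  the trajectory itself makes its limit \<open>0\<close>, and the functional bounds the distance to \<open>p\<close>.
\<close>

theorem convergence:
  "\<exists>p. (\<forall>i. p $ i \<in> {a $ i..b $ i}) \<and> (x \<longlongrightarrow> p) at_top"
proof -
  have "bounded (range (\<lambda>n. x (real n)))"
    by (rule bounded_subset[OF bounded_trajectory]) auto
  then obtain p r where r: "strict_mono r" and lim: "((\<lambda>n. x (real n)) \<circ> r) \<longlonglongrightarrow> p"
    using bounded_imp_convergent_subsequence by blast
  define \<tau> where "\<tau> n = real (r n)" for n
  have \<tau>: "filterlim \<tau> at_top sequentially"
    unfolding \<tau>_def
    by (rule filterlim_compose[OF filterlim_real_sequentially filterlim_subseq[OF r]])
  have x\<tau>: "(\<lambda>n. x (\<tau> n)) \<longlonglongrightarrow> p"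
    using lim by (simp add: \<tau>_def o_def)
  have x\<tau>i: "(\<lambda>n. x (\<tau> n) $ i) \<longlonglongrightarrow> p $ i" for i
    by (rule tendsto_vec_nth[OF x\<tau>])
  have p: "p $ i \<in> {a $ i..b $ i}" for i
  proof -
    have "(\<lambda>n. phi (\<tau> n) i) \<longlonglongrightarrow> deadband (a $ i) (b $ i) (p $ i)"
      by (intro tendsto_intros x\<tau>i)
    moreover have "(\<lambda>n. phi (\<tau> n) i) \<longlonglongrightarrow> 0"
      by (rule filterlim_compose[OF phi_tendsto_0 \<tau>])
    ultimately show ?thesis
      using LIMSEQ_unique deadband_eq_0_iff[OF a_le_b] by blast
  qed
  have "(\<lambda>n. distance_functional p (\<tau> n)) \<longlonglongrightarrow>
      (p - p) \<bullet> (D *v (p - p)) / 2 + (\<Sum>i\<in>UNIV. C $ i * (p $ i - p $ i) * 0) + weight * 0"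
    unfolding distance_functional_def
    by (intro tendsto_intros x\<tau> x\<tau>i filterlim_compose[OF energy_tendsto_0 \<tau>]
        filterlim_compose[OF q_tendsto_0 \<tau>]
        bounded_linear.tendsto[OF matrix_vector_mul_bounded_linear]) auto
  then have sub: "(\<lambda>n. distance_functional p (\<tau> n)) \<longlonglongrightarrow> 0" by simp
  have W: "(distance_functional p \<longlongrightarrow> 0) at_top"
  proof (rule order_tendstoI)
    fix e :: real assume "e < 0"
    then show "\<forall>\<^sub>F t in at_top. e < distance_functional p t"
      by (intro always_eventually allI less_le_trans[OF _ distance_functional_nonneg])
  next
    fix e :: real assume "0 < e"
    then have "\<forall>\<^sub>F n in sequentially. distance_functional p (\<tau> n) < e"
      by (rule order_tendstoD(2)[OF sub])
    then obtain n where n: "distance_functional p (\<tau> n) < e"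
      by (auto simp: eventually_sequentially)
    show "\<forall>\<^sub>F t in at_top. distance_functional p t < e"
      using eventually_ge_at_top[of "\<tau> n"]
    proof eventually_elim
      case (elim t)
      then show ?case
        using distance_functional_nonincreasing[OF p, of "\<tau> n" t] n by (simp add: \<tau>_def)
    qed
  qed
  have "((\<lambda>t. x t $ i - p $ i) \<longlongrightarrow> 0) at_top" for i
    by (rule tendsto_0_if_weighted_square_le[OF P_pos component_le_distance_functional])
      (use tendsto_mult_right_zero[OF W, of 4] in simp)
  then have "(x \<longlongrightarrow> p) at_top"
    by (intro vec_tendstoI) (simp add: LIM_zero_iff)
  with p show ?thesis by blast
qed

end

section \<open>Weighted graph Laplacians\<close>

lemma weighted_laplacian_symmetric:
  assumes "pair_graph G"
    and w: "\<And>i j. (i, j) \<in> parcs G \<Longrightarrow> w i j = w j i"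
  shows "transpose (weighted_laplacian G w) = weighted_laplacian G w"
proof -
  interpret pair_graph G by fact
  show ?thesis
    using w arcs_symmetric
    by (auto simp: vec_eq_iff transpose_def weighted_laplacian_def neighbours_def)
qed

text \<open>
  Exchanging the two summation indices and averaging turns the quadratic form into
  \<open>\<Sum>\<^sub>i \<Sum>\<^sub>j w\<^sub>i\<^sub>j (y\<^sub>i - y\<^sub>j)\<^sup>2 / 2\<close>.
\<close>

lemma weighted_laplacian_nonneg:
  fixes G :: "'n::finite pair_pre_digraph"
  assumes "pair_graph G"
    and pos: "\<And>i j. (i, j) \<in> parcs G \<Longrightarrow> w i j \<ge> 0"
    and w: "\<And>i j. (i, j) \<in> parcs G \<Longrightarrow> w i j = w j i"
  shows "0 \<le> y \<bullet> (weighted_laplacian G w *v y)"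
proof -
  interpret pair_graph G by fact
  define c where "c i j = (if (i, j) \<in> parcs G then w i j else 0)" for i j
  have c_sym: "c i j = c j i" for i j
    using w arcs_symmetric by (auto simp: c_def)
  have form: "y \<bullet> (weighted_laplacian G w *v y)
      = (\<Sum>i\<in>UNIV. \<Sum>j\<in>UNIV. c i j * (y $ i * (y $ i - y $ j)))" (is "_ = ?S")
    unfolding inner_vec_def weighted_laplacian_mult_component[OF assms(1)] inner_real_def
      sum_distrib_left
    by (intro sum.cong refl sum.mono_neutral_cong_left) (auto simp: c_def neighbours_def)
  have "?S = (\<Sum>i\<in>UNIV. \<Sum>j\<in>UNIV. c i j * (y $ j * (y $ j - y $ i)))"
    by (subst sum.swap) (simp add: c_sym)
  then have "2 * ?S = ?S + (\<Sum>i\<in>UNIV. \<Sum>j\<in>UNIV. c i j * (y $ j * (y $ j - y $ i)))"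
    by simp
  also have "\<dots> = (\<Sum>i\<in>UNIV. \<Sum>j\<in>UNIV. c i j * (y $ i - y $ j)\<^sup>2)"
    unfolding sum.distrib[symmetric]
    by (intro sum.cong refl) (simp add: power2_eq_square algebra_simps)
  also have "\<dots> \<ge> 0"
    by (intro sum_nonneg mult_nonneg_nonneg) (auto simp: c_def pos)
  finally show ?thesis using form by simp
qed

section \<open>Convergence into the voltage range\<close>

theorem theorem6:
  fixes G :: "'n::finite pair_pre_digraph"
    and R :: "'n \<Rightarrow> 'n \<Rightarrow> real"
    and C KP KI Vnom Vup Vlo Iinj :: "real ^ 'n"
    and V z :: "real \<Rightarrow> real ^ 'n"
  defines "E \<equiv> diag_matrix (\<chi> i. inverse (C $ i))"
    and "L \<equiv> weighted_laplacian G (\<lambda>i j. 1 / R i j)"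
  assumes graph: "pair_graph G" "pverts G = UNIV"
    and connected: "Digraph_Component.connected (with_proj G)"
    and resistance: "\<And>i j. (i, j) \<in> parcs G \<Longrightarrow> R i j > 0"
                    "\<And>i j. (i, j) \<in> parcs G \<Longrightarrow> R i j = R j i"
    and capacitance: "\<And>i. C $ i > 0"
    and gains: "\<And>i. KP $ i > 0" "\<And>i. KI $ i > 0"
    and nominal_equal: "\<And>i j. Vnom $ i = Vnom $ j"
    and nominal_in_range: "\<And>i. Vlo $ i \<le> Vnom $ i" "\<And>i. Vnom $ i \<le> Vup $ i"
    and bounds_uniform: "\<And>i j. Vup $ i = Vup $ j" "\<And>i j. Vlo $ i = Vlo $ j"
    and V_dynamics: "\<And>t. t \<ge> 0 \<Longrightarrow>
          (V has_vector_derivative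
            (- (E *v (L *v V t))
             - E *v (diag_matrix KP *v (V t - Vnom))
             - E *v (diag_matrix KI *v z t)
             + E *v Iinj)) (at t within {0..})"
    and z_dynamics: "\<And>t. t \<ge> 0 \<Longrightarrow>
          (z has_vector_derivative
            (pos_part (V t - Vup) - pos_part (Vlo - V t))) (at t within {0..})"
  shows "\<forall>i. \<exists>l \<in> {Vlo $ i .. Vup $ i}. ((\<lambda>t. V t $ i) \<longlongrightarrow> l) at_top"
proof -
  define D where "D = L + diag_matrix KP"
  define q where "q t = - (E *v (L *v V t)) - E *v (diag_matrix KP *v (V t - Vnom))
             - E *v (diag_matrix KI *v z t) + E *v Iinj" for t
  have L_sym: "transpose L = L"
    unfolding L_def using resistance(2) by (intro weighted_laplacian_symmetric graph) auto
  have L_nonneg: "0 \<le> y \<bullet> (L *v y)" for y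
    unfolding L_def using resistance
    by (intro weighted_laplacian_nonneg graph) (auto simp: less_imp_le)
  \<comment> \<open>In this form the derivative of \<open>q\<close> can be read off from those of \<open>V\<close> and \<open>z\<close>; the constants
    \<open>Vnom\<close> and \<open>Iinj\<close> drop out.\<close>
  have q_component: "q t $ i = (- (L *v V t) $ i - KP $ i * (V t $ i - Vnom $ i)
      - KI $ i * z t $ i + Iinj $ i) / C $ i" for t i
    unfolding q_def E_def
    by (simp add: diag_matrix_mult_component divide_inverse algebra_simps)
  have V_deriv: "(V has_vector_derivative q t) (at t within {0..})" if "t \<ge> 0" for t
    unfolding q_def using V_dynamics[OF that] .
  interpret damped_deadband_system D C KP KI Vlo Vup V q
  proof
    show "transpose D = D"
      using L_sym by (auto simp: D_def vec_eq_iff transpose_def diag_matrix_def)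
    show "(\<Sum>i\<in>UNIV. KP $ i * (y $ i)\<^sup>2) \<le> y \<bullet> (D *v y)" for y
    proof -
      have "y \<bullet> (diag_matrix KP *v y) = (\<Sum>i\<in>UNIV. KP $ i * (y $ i)\<^sup>2)"
        by (simp add: inner_vec_def diag_matrix_mult_component power2_eq_square mult_ac)
      then show ?thesis
        using L_nonneg[of y] by (simp add: D_def matrix_vector_mult_add_rdistrib inner_add_right)
    qed
    show "Vlo $ i \<le> Vup $ i" for i
      using nominal_in_range[of i] by (rule order_trans)
    show "((\<lambda>t. q t $ i) has_real_derivative
        - ((D *v q t) $ i + KI $ i * deadband (Vlo $ i) (Vup $ i) (V t $ i)) / C $ i)
        (at t within {0..})" if "t \<ge> 0" for t i
    proof -
      have V: "((\<lambda>t. V t $ i) has_real_derivative q t $ i) (at t within {0..})"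
        unfolding has_real_derivative_iff_has_vector_derivative
        by (rule bounded_linear.has_vector_derivative[OF bounded_linear_vec_nth V_deriv[OF that]])
      have LV: "((\<lambda>t. (L *v V t) $ i) has_real_derivative (L *v q t) $ i) (at t within {0..})"
        unfolding has_real_derivative_iff_has_vector_derivative
        by (rule bounded_linear.has_vector_derivative[OF bounded_linear_vec_nth
            bounded_linear.has_vector_derivative[OF matrix_vector_mul_bounded_linear V_deriv[OF that]]])
      have "((\<lambda>t. z t $ i) has_real_derivative (pos_part (V t - Vup) - pos_part (Vlo - V t)) $ i)
          (at t within {0..})"
        unfolding has_real_derivative_iff_has_vector_derivative
        by (rule bounded_linear.has_vector_derivative[OF bounded_linear_vec_nth z_dynamics[OF that]])
      then have z: "((\<lambda>t. z t $ i) has_real_derivative deadband (Vlo $ i) (Vup $ i) (V t $ i))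
          (at t within {0..})"
        by (simp add: pos_part_def deadband_def)
      have "((\<lambda>t. (- (L *v V t) $ i - KP $ i * (V t $ i - Vnom $ i) - KI $ i * z t $ i + Iinj $ i)
            / C $ i) has_real_derivative
          (- (L *v q t) $ i - KP $ i * q t $ i - KI $ i * deadband (Vlo $ i) (Vup $ i) (V t $ i))
            / C $ i) (at t within {0..})"
        by (rule DERIV_cdivide) (auto intro!: derivative_eq_intros V LV z)
      then show ?thesis
        unfolding q_component[symmetric]
        by (rule DERIV_cong)
          (simp add: D_def matrix_vector_mult_add_rdistrib diag_matrix_mult_component)
    qed
  qed (use capacitance gains V_deriv in auto)
  obtain p where p: "\<And>i. p $ i \<in> {Vlo $ i..Vup $ i}" "(V \<longlongrightarrow> p) at_top"
    using convergence by blast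
  show ?thesis
  proof
    fix i
    show "\<exists>l\<in>{Vlo $ i..Vup $ i}. ((\<lambda>t. V t $ i) \<longlongrightarrow> l) at_top"
      using tendsto_vec_nth[OF p(2), of i] p(1)[of i] by (rule bexI)
  qed
qed

end
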